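(* Suppose $\mu$ is any equicontractive, self-similar measure on $\mathbb{R}$ of finite type with support $[0,1]$. Then $\overline{\dim}_\Phi\mu<\infty$ for any constant dimension function $\Phi=\delta>0$.
   Context: Let $S_j(x)=r_{\min}x+d_j$, $j=0,\dots,m$ ($m\ge1$), be an equicontractive IFS of similarities of $\mathbb{R}$ with common contraction factor $0<r_{\min}<1$, and let $p_j>0$ with $\sum_{j=0}^m p_j=1$. The associated self-similar measure is the unique Borel probability measure $\mu$ with $\mu(E)=\sum_j p_j\,\mu(S_j^{-1}(E))$ for all Borel $E$; its support is the self-similar set, i.e. the unique non-empty compact $K$ with $K=\bigcup_j S_j(K)$. For a word $w=(j_1,\dots,j_n)$, $S_w=S_{j_1}\circ\cdots\circ S_{j_n}$. The IFS and $\mu$ are of finite type if there is a finite set $F\subseteq\mathbb{R}$ such that whenever $v,w$ are words on $\{0,\dots,m\}$ of the same length $n$ and $c=\mathrm{diam}\,K$, either $|S_v(0)-S_w(0)|>c\,r_{\min}^n$ or $r_{\min}^{-n}|S_v(0)-S_w(0)|\in F$. For a function $\Phi:(0,1)\to[0,\infty)$, $\overline{\dim}_\Phi\mu$ is the infimum of all $\alpha$ for which there exist $C_1,C_2>0$ such that for all $0<r<R^{1+\Phi(R)}\le R\le C_1$ and all $x\in\mathrm{supp}\,\mu$, $\mu(B(x,R))/\mu(B(x,r))\le C_2(R/r)^\alpha$, where $B(x,R)$ is the open ball. *)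

theory Defs
  imports "HOL-Probability.Probability"
begin

definition sim :: "real \<Rightarrow> (nat \<Rightarrow> real) \<Rightarrow> nat \<Rightarrow> real \<Rightarrow> real" where
  "sim \<rho> d j x = \<rho> * x + d j"

definition sim_word :: "real \<Rightarrow> (nat \<Rightarrow> real) \<Rightarrow> nat list \<Rightarrow> real \<Rightarrow> real" where
  "sim_word \<rho> d w = foldr (\<lambda>j f. sim \<rho> d j \<circ> f) w id"

definition is_self_similar_set :: "nat \<Rightarrow> real \<Rightarrow> (nat \<Rightarrow> real) \<Rightarrow> real set \<Rightarrow> bool" where
  "is_self_similar_set m \<rho> d K \<longleftrightarrow>
     compact K \<and> K \<noteq> {} \<and> K = (\<Union>j\<in>{0..m}. sim \<rho> d j ` K)"

lemma ex1_self_similar_set: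
  assumes \<rho>: "0 < \<rho>" "\<rho> < 1"
  shows "\<exists>!K. is_self_similar_set m \<rho> d K"
proof (rule ex_ex1I)
  define H where "H A = (\<Union>j\<in>{0..m}. sim \<rho> d j ` A)" for A
  have H_mono: "H A \<subseteq> H B" if "A \<subseteq> B" for A B
    using that unfolding H_def by blast
  define D where "D = Max ((\<lambda>j. \<bar>d j\<bar>) ` {0..m})"
  have D: "\<bar>d j\<bar> \<le> D" if "j \<in> {0..m}" for j
    unfolding D_def using that by (intro Max_ge) auto
  have D0: "0 \<le> D" using D[of 0] by simp
  define L where "L = {- (D / (1 - \<rho>)) .. D / (1 - \<rho>)}"
  define K where "K = \<Union>{X. X \<subseteq> L \<and> X \<subseteq> H X}"
  have HL: "H L \<subseteq> L"
  proof
    fix y assume "y \<in> H L"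
    then obtain j x where j: "j \<in> {0..m}" and x: "x \<in> L" and y: "y = \<rho> * x + d j"
      unfolding H_def sim_def by auto
    have "\<bar>x\<bar> \<le> D / (1 - \<rho>)" using x unfolding L_def by auto
    hence "\<bar>\<rho> * x\<bar> \<le> \<rho> * (D / (1 - \<rho>))"
      using \<rho> by (simp only: abs_mult abs_of_pos mult_left_mono)
    hence "\<bar>y\<bar> \<le> \<rho> * (D / (1 - \<rho>)) + D" using D[OF j] y by linarith
    also have "\<dots> = D / (1 - \<rho>)" using \<rho> by (simp add: field_simps)
    finally show "y \<in> L" unfolding L_def by auto
  qed
  have KL: "K \<subseteq> L" unfolding K_def by blast
  have max: "X \<subseteq> K" if "X \<subseteq> L" "X \<subseteq> H X" for X using that unfolding K_def by blast
  have KH: "K \<subseteq> H K"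
  proof
    fix x assume "x \<in> K"
    then obtain X where X: "X \<subseteq> L" "X \<subseteq> H X" "x \<in> X" unfolding K_def by blast
    have "H X \<subseteq> H K" by (rule H_mono[OF max[OF X(1,2)]])
    with X show "x \<in> H K" by auto
  qed
  have HK: "H K \<subseteq> K"
    by (rule max[OF subset_trans[OF H_mono[OF KL] HL] H_mono[OF KH]])
  have cl: "closed L" "bounded L" unfolding L_def by auto
  have cKL: "closure K \<subseteq> L" using KL cl closure_minimal by blast
  have cK: "compact (closure K)"
    using bounded_subset[OF cl(2) KL] by (simp add: compact_closure)
  have "compact (H (closure K))"
    unfolding H_def sim_def using cK
    by (intro compact_UN compact_continuous_image continuous_intros) auto
  moreover have "K \<subseteq> H (closure K)" by (rule subset_trans[OF KH H_mono[OF closure_subset]])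
  ultimately have "closure K \<subseteq> H (closure K)"
    by (simp add: closure_minimal compact_imp_closed)
  hence "closure K \<subseteq> K" by (rule max[OF cKL])
  hence compK: "compact K" using cK closure_subset by (metis subset_antisym)
  have "d 0 / (1 - \<rho>) \<in> K"
  proof -
    have "\<bar>d 0 / (1 - \<rho>)\<bar> \<le> D / (1 - \<rho>)"
      using D[of 0] \<rho> by (simp add: divide_right_mono)
    hence 1: "{d 0 / (1 - \<rho>)} \<subseteq> L"
      unfolding L_def abs_le_iff by (metis atLeastAtMost_iff empty_subsetI insert_subset minus_le_iff)
    have "d 0 / (1 - \<rho>) = sim \<rho> d 0 (d 0 / (1 - \<rho>))"
      using \<rho> unfolding sim_def by (simp add: field_simps)
    hence "{d 0 / (1 - \<rho>)} \<subseteq> H {d 0 / (1 - \<rho>)}" unfolding H_def by auto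
    thus ?thesis using max[OF 1] by blast
  qed
  hence "is_self_similar_set m \<rho> d K"
    unfolding is_self_similar_set_def H_def[symmetric] using compK KH HK by auto
  thus "\<exists>K. is_self_similar_set m \<rho> d K" ..
next
  have sub: "A \<subseteq> B" if A: "is_self_similar_set m \<rho> d A" and B: "is_self_similar_set m \<rho> d B"
    for A B
  proof
    have "bounded A" "bounded B"
      using A B unfolding is_self_similar_set_def by (auto intro: compact_imp_bounded)
    then obtain a b where a: "\<And>x. x \<in> A \<Longrightarrow> \<bar>x\<bar> \<le> a" and b: "\<And>x. x \<in> B \<Longrightarrow> \<bar>x\<bar> \<le> b"
      unfolding bounded_iff by auto
    have near: "\<exists>y\<in>B. \<bar>x - y\<bar> \<le> \<rho> ^ n * (a + b)" if "x \<in> A" for x n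
      using that
    proof (induction n arbitrary: x)
      case 0
      obtain y where "y \<in> B" using B unfolding is_self_similar_set_def by blast
      with a[OF 0] b[of y] show ?case by (intro bexI[of _ y]) auto
    next
      case (Suc n)
      have "x \<in> (\<Union>j\<in>{0..m}. sim \<rho> d j ` A)"
        using A Suc.prems unfolding is_self_similar_set_def by blast
      then obtain j x' where j: "j \<in> {0..m}" and x': "x' \<in> A" "x = sim \<rho> d j x'" by blast
      obtain y where y: "y \<in> B" "\<bar>x' - y\<bar> \<le> \<rho> ^ n * (a + b)" using Suc.IH x' by blast
      have "sim \<rho> d j y \<in> B" using B j y(1) unfolding is_self_similar_set_def by blast
      moreover have "\<bar>x - sim \<rho> d j y\<bar> = \<rho> * \<bar>x' - y\<bar>"
        using \<rho> unfolding x' sim_def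
        by (simp add: abs_mult flip: right_diff_distrib)
      ultimately show ?case using y(2) \<rho> by (auto simp: mult.assoc intro!: bexI)
    qed
    fix x assume x: "x \<in> A"
    have "(\<lambda>n. \<rho> ^ n * (a + b)) \<longlonglongrightarrow> 0 * (a + b)"
      using \<rho> by (intro tendsto_intros LIMSEQ_power_zero) auto
    hence lim: "(\<lambda>n. \<rho> ^ n * (a + b)) \<longlonglongrightarrow> 0" by simp
    have "x \<in> closure B"
      unfolding closure_approachable
    proof (intro allI impI)
      fix e :: real assume "e > 0"
      then obtain n where "\<rho> ^ n * (a + b) < e"
        using order_tendstoD(2)[OF lim] by (auto simp: eventually_sequentially)
      with near[OF x, of n] show "\<exists>y\<in>B. dist y x < e"
        by (force simp: dist_real_def abs_minus_commute)
    qed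
    thus "x \<in> B" using B unfolding is_self_similar_set_def by (simp add: compact_imp_closed)
  qed
  show "A = B" if "is_self_similar_set m \<rho> d A" "is_self_similar_set m \<rho> d B" for A B
    using sub that by blast
qed

definition self_similar_set :: "nat \<Rightarrow> real \<Rightarrow> (nat \<Rightarrow> real) \<Rightarrow> real set" where
  "self_similar_set m \<rho> d = (THE K. is_self_similar_set m \<rho> d K)"

definition self_similar_measure ::
    "nat \<Rightarrow> real \<Rightarrow> (nat \<Rightarrow> real) \<Rightarrow> (nat \<Rightarrow> real) \<Rightarrow> real measure \<Rightarrow> bool" where
  "self_similar_measure m \<rho> d p \<mu> \<longleftrightarrow>
     prob_space \<mu> \<and> sets \<mu> = sets borel \<and>
     (\<forall>E\<in>sets borel. measure \<mu> E = (\<Sum>j=0..m. p j * measure \<mu> (sim \<rho> d j -` E)))"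

definition finite_type :: "nat \<Rightarrow> real \<Rightarrow> (nat \<Rightarrow> real) \<Rightarrow> bool" where
  "finite_type m \<rho> d \<longleftrightarrow>
     (\<exists>F :: real set. finite F \<and>
        (\<forall>n v w. v \<in> lists {0..m} \<and> w \<in> lists {0..m} \<and> length v = n \<and> length w = n \<longrightarrow>
           \<bar>sim_word \<rho> d v 0 - sim_word \<rho> d w 0\<bar> > diameter (self_similar_set m \<rho> d) * \<rho> ^ n \<or>
           \<bar>sim_word \<rho> d v 0 - sim_word \<rho> d w 0\<bar> / \<rho> ^ n \<in> F))"

definition measure_support :: "real measure \<Rightarrow> real set" where
  "measure_support \<mu> = {x. \<forall>\<epsilon>>0. measure \<mu> (ball x \<epsilon>) > 0}"

text \<open>\<open>\<Phi>\<close> is only meaningful on \<open>(0,1)\<close>, hence the restriction \<open>R < 1\<close>. The infimum is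
  taken in the extended reals, so the dimension is \<open>\<infinity>\<close> if no exponent is admissible.\<close>

definition upper_Phi_dim :: "(real \<Rightarrow> real) \<Rightarrow> real measure \<Rightarrow> ereal" where
  "upper_Phi_dim \<Phi> \<mu> = Inf (ereal ` {\<alpha>. \<exists>C1>0. \<exists>C2>0.
     \<forall>r R. 0 < r \<and> r < R powr (1 + \<Phi> R) \<and> R powr (1 + \<Phi> R) \<le> R \<and> R \<le> C1 \<and> 0 < R \<and> R < 1 \<longrightarrow>
       (\<forall>x\<in>measure_support \<mu>.
          measure \<mu> (ball x R) / measure \<mu> (ball x r) \<le> C2 * (R / r) powr \<alpha>)})"

end

theory Submission imports Defs begin

text \<open>
  A constant dimension function \<open>\<delta> > 0\<close> only compares scales \<open>r < R powr (1 + \<delta>)\<close>, and there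
  \<open>R / r\<close> is at least a fixed negative power of \<open>r\<close>. Since a probability measure gives
  the larger ball mass at most \<open>1\<close>, the dimension is finite as soon as \<open>\<mu>\<close> satisfies a uniform
  polynomial lower bound \<open>\<mu> (ball x r) \<ge> c * r powr s\<close> on its support
  (\<open>upper_Phi_dim_finite_of_lower_bound\<close>).

  Self-similarity supplies this bound (\<open>self_similar_measure_lower_bound\<close>). A point of the
  support lies in some cylinder of level \<open>n\<close>, that is, it is reached from another point of the
  support by \<open>n\<close> of the maps, and such a cylinder has diameter comparable to \<open>\<rho> ^ n\<close> and mass at
  least \<open>q ^ n\<close>, where \<open>q\<close> is the smallest weight. Hence \<open>s = ln q / ln \<rho>\<close> works.
\<close>

lemma vimage_sim_ball:
  assumes "0 < \<rho>"
  shows "sim \<rho> d j -` ball x \<epsilon> = ball ((x - d j) / \<rho>) (\<epsilon> / \<rho>)"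
proof -
  have "\<bar>x - (\<rho> * y + d j)\<bar> = \<rho> * \<bar>(x - d j) / \<rho> - y\<bar>" for y
  proof -
    have "x - (\<rho> * y + d j) = \<rho> * ((x - d j) / \<rho> - y)"
      using assms by (simp add: field_simps)
    thus ?thesis using assms by (simp only: abs_mult abs_of_pos)
  qed
  thus ?thesis
    using assms by (auto simp: sim_def dist_real_def field_simps)
qed

lemma self_similar_measure_ball:
  assumes "self_similar_measure m \<rho> d p \<mu>" "0 < \<rho>"
  shows "measure \<mu> (ball x \<epsilon>) = (\<Sum>j=0..m. p j * measure \<mu> (ball ((x - d j) / \<rho>) (\<epsilon> / \<rho>)))"
  using assms unfolding self_similar_measure_def by (simp add: vimage_sim_ball)

lemma measure_ball_mono:
  fixes \<mu> :: "real measure"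
  assumes "prob_space \<mu>" "sets \<mu> = sets borel" "ball x r \<subseteq> ball y t"
  shows "measure \<mu> (ball x r) \<le> measure \<mu> (ball y t)"
proof -
  interpret prob_space \<mu> by fact
  show ?thesis using assms by (intro finite_measure_mono) auto
qed

text \<open>
  If every preimage of \<open>x\<close> had a null ball around it, the smallest of these finitely many radii,
  scaled by \<open>\<rho>\<close>, would give a null ball around \<open>x\<close>. Iterating this pull-back produces the
  cylinders around \<open>x\<close>.
\<close>

lemma support_preimage:
  assumes ss: "self_similar_measure m \<rho> d p \<mu>" and \<rho>: "0 < \<rho>"
    and x: "x \<in> measure_support \<mu>"
  obtains j where "j \<in> {0..m}" "(x - d j) / \<rho> \<in> measure_support \<mu>"
proof (rule ccontr)
  assume "\<not> thesis"
  hence "\<forall>j\<in>{0..m}. (x - d j) / \<rho> \<notin> measure_support \<mu>" using that by blast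
  hence "\<forall>j\<in>{0..m}. \<exists>\<epsilon>>0. measure \<mu> (ball ((x - d j) / \<rho>) \<epsilon>) = 0"
    by (simp add: measure_support_def zero_less_measure_iff)
  then obtain e where e: "\<And>j. j \<in> {0..m} \<Longrightarrow> e j > 0 \<and> measure \<mu> (ball ((x - d j) / \<rho>) (e j)) = 0"
    by metis
  define \<epsilon> where "\<epsilon> = Min (e ` {0..m})"
  have "\<epsilon> > 0" unfolding \<epsilon>_def using e by (subst Min_gr_iff) auto
  have null: "measure \<mu> (ball ((x - d j) / \<rho>) \<epsilon>) = 0" if "j \<in> {0..m}" for j
  proof -
    have "\<epsilon> \<le> e j" unfolding \<epsilon>_def using that by (intro Min_le) auto
    hence "measure \<mu> (ball ((x - d j) / \<rho>) \<epsilon>) \<le> measure \<mu> (ball ((x - d j) / \<rho>) (e j))"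
      using ss unfolding self_similar_measure_def by (intro measure_ball_mono subset_ball) auto
    thus ?thesis using e[OF that] measure_nonneg[of \<mu>] by (metis antisym)
  qed
  have "measure \<mu> (ball x (\<rho> * \<epsilon>)) = 0"
    using self_similar_measure_ball[OF ss \<rho>, of x "\<rho> * \<epsilon>"] \<rho> null by simp
  moreover have "measure \<mu> (ball x (\<rho> * \<epsilon>)) > 0"
    using x \<rho> \<open>\<epsilon> > 0\<close> unfolding measure_support_def by auto
  ultimately show False by simp
qed

text \<open>
  Going down one level costs at most one factor \<open>q\<close>: among the summands of the invariance
  equation at \<open>x\<close>, keep the one whose centre is again in the support.
\<close>

lemma measure_ball_power_lower_bound:
  assumes ss: "self_similar_measure m \<rho> d p \<mu>" and \<rho>: "0 < \<rho>"
    and q: "0 \<le> q" "\<And>j. j \<in> {0..m} \<Longrightarrow> q \<le> p j"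
    and base: "\<And>y. y \<in> measure_support \<mu> \<Longrightarrow> c \<le> measure \<mu> (ball y L)"
    and x: "x \<in> measure_support \<mu>"
  shows "q ^ n * c \<le> measure \<mu> (ball x (L * \<rho> ^ n))"
  using x
proof (induction n arbitrary: x)
  case 0
  then show ?case using base by simp
next
  case (Suc n)
  obtain j where j: "j \<in> {0..m}" and pre: "(x - d j) / \<rho> \<in> measure_support \<mu>"
    using support_preimage[OF ss \<rho> Suc.prems] .
  let ?f = "\<lambda>i. p i * measure \<mu> (ball ((x - d i) / \<rho>) (L * \<rho> ^ n))"
  have "q ^ Suc n * c = q * (q ^ n * c)" by simp
  also have "\<dots> \<le> q * measure \<mu> (ball ((x - d j) / \<rho>) (L * \<rho> ^ n))"
    using Suc.IH[OF pre] q(1) by (intro mult_left_mono)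
  also have "\<dots> \<le> ?f j"
    using q(2)[OF j] by (intro mult_right_mono) auto
  also have "\<dots> \<le> (\<Sum>i=0..m. ?f i)"
    using j q by (intro member_le_sum) (auto intro!: mult_nonneg_nonneg order_trans[OF q(1) q(2)])
  also have "\<dots> = measure \<mu> (ball x (L * \<rho> ^ Suc n))"
    using self_similar_measure_ball[OF ss \<rho>, of x "L * \<rho> ^ Suc n"] \<rho> by simp
  finally show ?case .
qed

lemma self_similar_measure_lower_bound:
  assumes \<rho>: "0 < \<rho>" "\<rho> < 1"
    and p: "\<And>j. j \<in> {0..m} \<Longrightarrow> p j > 0" "(\<Sum>j=0..m. p j) = 1"
    and ss: "self_similar_measure m \<rho> d p \<mu>"
    and bdd: "bounded (measure_support \<mu>)"
  obtains c s where "c > 0" "s \<ge> 0"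
    "\<And>x r. x \<in> measure_support \<mu> \<Longrightarrow> 0 < r \<Longrightarrow> r \<le> 1 \<Longrightarrow> c * r powr s \<le> measure \<mu> (ball x r)"
proof (cases "measure_support \<mu> = {}")
  case True
  then show ?thesis using that[of 1 0] by simp
next
  case False
  then obtain x0 where x0: "x0 \<in> measure_support \<mu>" by blast
  obtain D where D: "\<And>x. x \<in> measure_support \<mu> \<Longrightarrow> dist x0 x \<le> D"
    using bdd by (meson bounded_any_center)
  have "D \<ge> 0" using D[OF x0] by simp
  define L where "L = D + 1"
  define b where "b = measure \<mu> (ball x0 1)"
  have L: "L \<ge> 1" using \<open>D \<ge> 0\<close> by (simp add: L_def)
  have b: "b > 0" using x0 unfolding b_def measure_support_def by simp
  have base: "b \<le> measure \<mu> (ball y L)" if "y \<in> measure_support \<mu>" for y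
  proof -
    have "ball x0 1 \<subseteq> ball y L"
      using D[OF that] by (auto simp: L_def dist_real_def)
    thus ?thesis
      using ss unfolding b_def self_similar_measure_def by (intro measure_ball_mono) auto
  qed
  define q where "q = Min (p ` {0..m})"
  have qp: "q \<le> p j" if "j \<in> {0..m}" for j unfolding q_def using that by (intro Min_le) auto
  have q0: "q > 0" unfolding q_def using p(1) by (subst Min_gr_iff) auto
  have "p 0 \<le> (\<Sum>j=0..m. p j)"
    using p(1) by (intro member_le_sum) (auto intro: less_imp_le)
  hence q1: "q \<le> 1" using qp[of 0] p(2) by simp
  \<comment> \<open>The exponent for which \<open>q powr t = (\<rho> powr t) powr s\<close>.\<close>
  define s where "s = ln q / ln \<rho>"
  have ln\<rho>: "ln \<rho> < 0" using \<rho> by simp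
  have s0: "s \<ge> 0"
    unfolding s_def using q0 q1 ln\<rho> by (intro divide_nonpos_nonpos) auto
  define c where "c = b * q * L powr - s"
  have "c > 0" using b q0 L by (simp add: c_def)
  moreover have "c * r powr s \<le> measure \<mu> (ball x r)"
    if x: "x \<in> measure_support \<mu>" and r: "0 < r" "r \<le> 1" for x r
  proof -
    \<comment> \<open>The first level at which the cylinders fit into the ball; rounding up costs one factor \<open>q\<close>.\<close>
    define t where "t = ln (r / L) / ln \<rho>"
    define n where "n = nat \<lceil>t\<rceil>"
    have rL: "0 < r / L" "r / L \<le> 1" using r L by auto
    have "t \<ge> 0" unfolding t_def using rL ln\<rho> by (intro divide_nonpos_nonpos) auto
    hence n: "t \<le> real n" "real n \<le> t + 1" unfolding n_def by linarith+
    have "\<rho> ^ n = \<rho> powr real n" using \<rho> by (simp add: powr_realpow)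
    also have "\<dots> \<le> \<rho> powr t" using n \<rho> by (intro powr_mono') auto
    also have "\<dots> = r / L" using \<rho> ln\<rho> rL by (simp add: powr_def t_def)
    finally have "L * \<rho> ^ n \<le> r" using L by (simp add: field_simps)
    hence sub: "ball x (L * \<rho> ^ n) \<subseteq> ball x r" by (rule subset_ball)
    have "q * (r / L) powr s = q * q powr t"
      using q0 r L ln\<rho> by (simp add: powr_def t_def s_def)
    also have "\<dots> = q powr (t + 1)" using q0 by (simp add: powr_add)
    also have "\<dots> \<le> q powr real n" using n q0 q1 by (intro powr_mono') auto
    also have "\<dots> = q ^ n" using q0 by (simp add: powr_realpow)
    finally have "q * (r / L) powr s * b \<le> q ^ n * b" using b by (intro mult_right_mono) auto
    also have "\<dots> \<le> measure \<mu> (ball x (L * \<rho> ^ n))"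
      using measure_ball_power_lower_bound[OF ss \<rho>(1) less_imp_le[OF q0] qp base x] .
    also have "\<dots> \<le> measure \<mu> (ball x r)"
      using ss sub unfolding self_similar_measure_def by (intro measure_ball_mono) auto
    also have "q * (r / L) powr s * b = c * r powr s"
      using r L by (simp add: c_def powr_divide powr_minus field_simps)
    finally show ?thesis .
  qed
  ultimately show ?thesis using that s0 by blast
qed

text \<open>
  For \<open>r < R powr (1 + \<delta>)\<close> one has \<open>R / r \<ge> r powr (-\<delta> / (1 + \<delta>))\<close>, so the exponent
  \<open>s * (1 + \<delta>) / \<delta>\<close> is large enough for \<open>(R / r) powr \<alpha>\<close> to dominate \<open>r powr - s\<close>.
\<close>

lemma upper_Phi_dim_finite_of_lower_bound:
  fixes \<mu> :: "real measure"
  assumes "prob_space \<mu>" "c > 0" "s \<ge> 0" and \<delta>: "\<delta> > 0"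
    and low: "\<And>x r. x \<in> measure_support \<mu> \<Longrightarrow> 0 < r \<Longrightarrow> r \<le> 1 \<Longrightarrow> c * r powr s \<le> measure \<mu> (ball x r)"
  shows "upper_Phi_dim (\<lambda>_. \<delta>) \<mu> < \<infinity>"
proof -
  interpret prob_space \<mu> by fact
  define \<alpha> where "\<alpha> = s * (1 + \<delta>) / \<delta>"
  have \<alpha>: "\<alpha> \<ge> 0" using assms by (simp add: \<alpha>_def)
  have bound: "measure \<mu> (ball x R) / measure \<mu> (ball x r) \<le> 1 / c * (R / r) powr \<alpha>"
    if r: "0 < r" "r < R powr (1 + \<delta>)" "R powr (1 + \<delta>) \<le> R" and R: "0 < R" "R < 1"
      and x: "x \<in> measure_support \<mu>" for r R x
  proof -
    have "r powr (1 / (1 + \<delta>)) \<le> (R powr (1 + \<delta>)) powr (1 / (1 + \<delta>))"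
      using r \<delta> by (intro powr_mono2) auto
    also have "\<dots> = R" using R \<delta> by (simp add: powr_powr)
    finally have "r powr (1 / (1 + \<delta>)) / r \<le> R / r" using r by (intro divide_right_mono) auto
    moreover have "r powr (1 / (1 + \<delta>)) / r = r powr (1 / (1 + \<delta>) - 1)"
      using r by (simp add: powr_diff)
    ultimately have "(r powr (1 / (1 + \<delta>) - 1)) powr \<alpha> \<le> (R / r) powr \<alpha>"
      using \<alpha> by (intro powr_mono2) auto
    moreover have "(1 / (1 + \<delta>) - 1) * \<alpha> = - s"
      using \<delta> by (simp add: \<alpha>_def divide_simps)
    ultimately have "r powr - s \<le> (R / r) powr \<alpha>" by (simp add: powr_powr)
    hence key: "1 / (c * r powr s) \<le> 1 / c * (R / r) powr \<alpha>"
      using \<open>c > 0\<close> by (simp add: powr_minus divide_simps)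
    have "0 < c * r powr s" using \<open>c > 0\<close> r by simp
    moreover have "c * r powr s \<le> measure \<mu> (ball x r)" using low x r R by simp
    ultimately have "measure \<mu> (ball x R) / measure \<mu> (ball x r) \<le> 1 / (c * r powr s)"
      by (intro frac_le) auto
    with key show ?thesis by linarith
  qed
  have "upper_Phi_dim (\<lambda>_. \<delta>) \<mu> \<le> ereal \<alpha>"
    unfolding upper_Phi_dim_def
    by (rule Inf_lower, rule imageI, rule CollectI, rule exI[of _ 1], rule conjI, simp,
        rule exI[of _ "1 / c"]) (use bound \<open>c > 0\<close> in auto)
  also have "\<dots> < \<infinity>" by simp
  finally show ?thesis .
qed

theorem corollary3p8:
  fixes m :: nat and \<rho> :: real and d p :: "nat \<Rightarrow> real" and \<mu> :: "real measure" and \<delta> :: real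
  assumes "m \<ge> 1"
    and "0 < \<rho>" and "\<rho> < 1"
    and "\<And>j. j \<in> {0..m} \<Longrightarrow> p j > 0"
    and "(\<Sum>j=0..m. p j) = 1"
    and "self_similar_measure m \<rho> d p \<mu>"
    and "finite_type m \<rho> d"
    and "measure_support \<mu> = {0..1}"
    and "\<delta> > 0"
  shows "upper_Phi_dim (\<lambda>_. \<delta>) \<mu> < \<infinity>"
proof -
  have "bounded (measure_support \<mu>)" using assms(8) by simp
  then obtain c s where "c > 0" "s \<ge> 0" and
    "\<And>x r. x \<in> measure_support \<mu> \<Longrightarrow> 0 < r \<Longrightarrow> r \<le> 1 \<Longrightarrow> c * r powr s \<le> measure \<mu> (ball x r)"
    using self_similar_measure_lower_bound[OF assms(2-6)] by metis
  moreover have "prob_space \<mu>" using assms(6) by (simp add: self_similar_measure_def)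
  ultimately show ?thesis using \<open>\<delta> > 0\<close> by (intro upper_Phi_dim_finite_of_lower_bound)
qed

end
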